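(* Let $m\ge 1$. The generating function $\sum_\lambda x^{|\lambda|}$, where $\lambda$ ranges over partitions $\lambda=(\lambda_1,\dots,\lambda_m)$ into exactly $m$ parts such that either $\lambda_1=1$ or there exists $k\in\{2,\dots,m\}$ with $\lambda_{k-1}>\lambda_k=k$, equals $$\frac{x^m}{1-x}\sum_{i=1}^{m}\frac{(-1)^{i}x^{i(i-1)/2}(x^i-1)}{(x)_{m-i}}.$$
   Context: Partitions are written with parts $\lambda_1\ge\lambda_2\ge\dots\ge\lambda_m>0$ and $|\lambda|=\sum_i\lambda_i$. For $j\ge0$, $(x)_0=1$ and $(x)_j=\prod_{i=1}^j(1-x^i)$. *)

theory Defs
  imports "HOL-Computational_Algebra.Formal_Power_Series"
begin

text \<open>
  Partitions are weakly decreasing lists of positive naturals.  The \<open>k\<close>-th part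
  \<open>\<lambda>\<^sub>k\<close> of the text (counted from 1) is \<open>part \<lambda> k\<close>; it is only meaningful for
  \<open>1 \<le> k \<le> length \<lambda>\<close>.
\<close>

definition is_partition :: "nat list \<Rightarrow> bool" where
  "is_partition lam \<longleftrightarrow> sorted_wrt (\<ge>) lam \<and> (\<forall>p\<in>set lam. 0 < p)"

definition part :: "nat list \<Rightarrow> nat \<Rightarrow> nat" where
  "part lam k = lam ! (k - 1)"

definition partitions_with_parts :: "nat \<Rightarrow> nat list set" where
  "partitions_with_parts m = {lam. is_partition lam \<and> length lam = m}"

text \<open>
  The formal sum of \<open>x ^ |\<lambda>|\<close> over \<open>\<lambda> \<in> A\<close>, as a formal power series.  It is well defined
  when \<open>A\<close> contains finitely many lists of each size; for sets of partitions into a fixed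
  number of parts this is lemma \<open>finite_partitions_with_parts_of_size\<close> below.
\<close>

definition size_gf :: "nat list set \<Rightarrow> rat fps" where
  "size_gf A = Abs_fps (\<lambda>n. of_nat (card {lam \<in> A. sum_list lam = n}))"

lemma finite_partitions_with_parts_of_size:
  assumes "A \<subseteq> partitions_with_parts m"
  shows "finite {lam \<in> A. sum_list lam = n}"
proof (rule finite_subset)
  show "{lam \<in> A. sum_list lam = n} \<subseteq> {lam. set lam \<subseteq> {..n} \<and> length lam = m}"
    using assms by (auto simp: partitions_with_parts_def dest: member_le_sum_list)
  show "finite {lam. set lam \<subseteq> {..n} \<and> length lam = m}"
    by (rule finite_lists_length_eq) simp
qed

text \<open>\<open>(x)\<^sub>j\<close>, with \<open>x\<close> the formal variable.\<close>

definition x_poch :: "nat \<Rightarrow> rat fps" where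
  "x_poch j = (\<Prod>i=1..j. 1 - fps_X ^ i)"

end

theory Submission
  imports Defs "HOL-Library.Ramsey"
begin

text \<open>
  A partition \<open>\<lambda>\<close> into exactly \<open>m\<close> parts is encoded by the set \<open>B\<close> of its first column hook
  lengths \<open>\<lambda>\<^sub>i + m - i\<close>, an \<open>m\<close>-element set of positive integers with sum
  \<open>|\<lambda>| + m (m - 1) / 2\<close>. The condition on \<open>\<lambda>\<close> says that \<open>m \<in> B\<close> and \<open>m + 1 \<notin> B\<close>.
  Write \<open>e\<^sub>r(A)\<close> for the generating function, by sum, of the \<open>r\<close>-element subsets of \<open>A\<close>, and
  let \<open>P\<close> be the set of positive integers. From
  \<open>e\<^sub>r\<^sub>+\<^sub>1(A) = e\<^sub>r\<^sub>+\<^sub>1(A - {a}) + x\<^sup>a e\<^sub>r(A - {a})\<close> one gets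
  \<open>e\<^sub>r(A - {a}) = (\<Sum>i\<le>r. (- x\<^sup>a)\<^sup>i e\<^sub>r\<^sub>-\<^sub>i(A))\<close>, and also
  \<open>(1 - x) x\<^sup>m e\<^sub>m\<^sub>-\<^sub>1(P - {m, m + 1}) = e\<^sub>m(P - {m + 1}) - e\<^sub>m(P - {m})\<close>.
  With \<open>e\<^sub>r(P) = x\<^bsup>r(r + 1)/2\<^esup> / (x)\<^sub>r\<close> this is the claimed formula.
\<close>

unbundle fps_syntax

section \<open>Counting generating functions by weight\<close>

definition weight_gf :: "('a \<Rightarrow> nat) \<Rightarrow> 'a set \<Rightarrow> rat fps" where
  "weight_gf w S = Abs_fps (\<lambda>n. of_nat (card {s \<in> S. w s = n}))"

lemma size_gf_eq_weight_gf: "size_gf A = weight_gf sum_list A"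
  by (simp add: size_gf_def weight_gf_def)

lemma weight_gf_bij_betw:
  assumes bij: "bij_betw f S T" and w: "\<And>s. s \<in> S \<Longrightarrow> w' (f s) = w s + k"
  shows "weight_gf w' T = fps_X ^ k * weight_gf w S"
proof (rule fps_ext)
  fix n
  show "weight_gf w' T $ n = (fps_X ^ k * weight_gf w S) $ n"
  proof (cases "n < k")
    case True
    have "{t \<in> T. w' t = n} = {}"
      using bij w True by (force simp: bij_betw_def)
    then have "card {t \<in> T. w' t = n} = 0"
      by (simp only: card.empty)
    then show ?thesis
      using True by (simp add: weight_gf_def fps_X_power_mult_nth)
  next
    case False
    have "bij_betw f {s \<in> S. w s = n - k} {t \<in> T. w' t = n}"
      unfolding bij_betw_def
    proof
      show "inj_on f {s \<in> S. w s = n - k}"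
        using bij by (auto simp: bij_betw_def inj_on_def)
      show "f ` {s \<in> S. w s = n - k} = {t \<in> T. w' t = n}"
        using bij w False by (force simp: bij_betw_def)
    qed
    then have "card {s \<in> S. w s = n - k} = card {t \<in> T. w' t = n}"
      by (rule bij_betw_same_card)
    then show ?thesis
      using False by (simp add: weight_gf_def fps_X_power_mult_nth)
  qed
qed

text \<open>The fibres are taken finite because \<open>card\<close> sends an infinite set to 0,
  which would break additivity of the coefficients.\<close>

lemma weight_gf_Un:
  assumes "S \<inter> T = {}" "\<And>n. finite {s \<in> S \<union> T. w s = n}"
  shows "weight_gf w (S \<union> T) = weight_gf w S + weight_gf w T"
proof (rule fps_ext)
  fix n
  have "{s \<in> S \<union> T. w s = n} = {s \<in> S. w s = n} \<union> {s \<in> T. w s = n}"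
    by auto
  moreover have "card ({s \<in> S. w s = n} \<union> {s \<in> T. w s = n})
      = card {s \<in> S. w s = n} + card {s \<in> T. w s = n}"
    using assms(1) by (intro card_Un_disjoint finite_subset[OF _ assms(2)[of n]]) auto
  ultimately show "weight_gf w (S \<union> T) $ n = (weight_gf w S + weight_gf w T) $ n"
    by (simp add: weight_gf_def)
qed

section \<open>Generating functions of r-element sets of naturals, by sum\<close>

definition nsets_gf :: "nat set \<Rightarrow> nat \<Rightarrow> rat fps" where
  "nsets_gf A r = weight_gf \<Sum> (nsets A r)"

lemma finite_nsets_sum_eq: "finite {B \<in> nsets A r. \<Sum> B = (n::nat)}"
proof (rule finite_subset)
  show "{B \<in> nsets A r. \<Sum> B = n} \<subseteq> Pow {..n}"
    by (auto simp: nsets_def intro: member_le_sum[where f="\<lambda>x. x"])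
qed simp

lemma nsets_gf_0: "nsets_gf A 0 = 1"
proof (rule fps_ext)
  fix n
  have "{B \<in> nsets A 0. \<Sum> B = n} = (if n = 0 then {{}} else {})"
    by (auto simp: nsets_def)
  then show "nsets_gf A 0 $ n = 1 $ n"
    by (simp add: nsets_gf_def weight_gf_def)
qed

lemma bij_betw_insert_nsets:
  assumes "a \<in> A"
  shows "bij_betw (insert a) (nsets (A - {a}) r) {B \<in> nsets A (Suc r). a \<in> B}"
proof (rule bij_betw_byWitness[where f' = "\<lambda>B. B - {a}"])
  show "insert a ` nsets (A - {a}) r \<subseteq> {B \<in> nsets A (Suc r). a \<in> B}"
    using assms by (auto simp: nsets_def card_insert_if)
  show "(\<lambda>B. B - {a}) ` {B \<in> nsets A (Suc r). a \<in> B} \<subseteq> nsets (A - {a}) r"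
    by (auto simp: nsets_def)
qed (auto simp: nsets_def)

lemma weight_gf_nsets_containing:
  assumes "a \<in> A"
  shows "weight_gf \<Sum> {B \<in> nsets A (Suc r). a \<in> B} = fps_X ^ a * nsets_gf (A - {a}) r"
  unfolding nsets_gf_def
proof (rule weight_gf_bij_betw[OF bij_betw_insert_nsets[OF assms]])
  fix B assume "B \<in> nsets (A - {a}) r"
  then have "finite B" "a \<notin> B"
    by (auto simp: nsets_def)
  then show "\<Sum> (insert a B) = \<Sum> B + a"
    by simp
qed

text \<open>Split the subsets by whether they contain \<open>a\<close>; deleting \<open>a\<close>
  from those that do lowers the sum by \<open>a\<close>.\<close>

lemma nsets_gf_Suc:
  assumes "a \<in> A"
  shows "nsets_gf A (Suc r) = nsets_gf (A - {a}) (Suc r) + fps_X ^ a * nsets_gf (A - {a}) r"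
proof -
  have split: "nsets A (Suc r) = nsets (A - {a}) (Suc r) \<union> {B \<in> nsets A (Suc r). a \<in> B}"
    by (auto simp: nsets_def)
  have "weight_gf \<Sum> (nsets A (Suc r))
      = weight_gf \<Sum> (nsets (A - {a}) (Suc r)) + weight_gf \<Sum> {B \<in> nsets A (Suc r). a \<in> B}"
    by (subst split, rule weight_gf_Un, force simp: nsets_def,
        subst split[symmetric], rule finite_nsets_sum_eq)
  then show ?thesis
    by (simp add: weight_gf_nsets_containing[OF assms] nsets_gf_def)
qed

text \<open>Iterate \<open>nsets_gf_Suc\<close>, solved for its first summand, down to r = 0. For
  the series in t with coefficients \<open>nsets_gf A r\<close>, this is division by 1 + x^a
  t.\<close>

lemma nsets_gf_remove:
  assumes "a \<in> A"
  shows "nsets_gf (A - {a}) r = (\<Sum>i\<le>r. (- 1) ^ i * fps_X ^ (a * i) * nsets_gf A (r - i))"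
proof (induction r)
  case (Suc r)
  have "nsets_gf (A - {a}) (Suc r) = nsets_gf A (Suc r) - fps_X ^ a * nsets_gf (A - {a}) r"
    by (simp add: nsets_gf_Suc[OF assms])
  also have "\<dots> = (\<Sum>i\<le>Suc r. (- 1) ^ i * fps_X ^ (a * i) * nsets_gf A (Suc r - i))"
    by (subst sum.atMost_Suc_shift)
      (simp add: Suc.IH sum_distrib_left sum_negf power_add mult_ac)
  finally show ?case .
qed (simp add: nsets_gf_0)

lemma nsets_gf_Suc_image:
  "nsets_gf (Suc ` A) r = fps_X ^ r * nsets_gf A r"
  unfolding nsets_gf_def
proof (rule weight_gf_bij_betw)
  show "bij_betw (image Suc) (nsets A r) (nsets (Suc ` A) r)"
    by (rule bij_betw_nsets) (simp add: bij_betw_def)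
  fix B assume "B \<in> nsets A r"
  then have "card B = r" "finite B"
    by (auto simp: nsets_def)
  then show "\<Sum> (Suc ` B) = \<Sum> B + r"
    by (simp add: sum.reindex sum_Suc)
qed

section \<open>Closed form for sets of positive integers, and removal of two neighbours\<close>

lemma x_poch_nth_0: "x_poch j $ 0 = 1"
  by (simp add: x_poch_def fps_prod_nth')

lemma x_poch_Suc: "x_poch (Suc r) = x_poch r * (1 - fps_X ^ Suc r)"
  by (simp add: x_poch_def)

text \<open>Sets of positive integers are sets of naturals with every element raised by 1, while
  sets of naturals either avoid 0 or contain it. Combining the two expresses the series for r + 1
  through itself and the series for r; collecting terms produces the factor 1 - x^(r+1).\<close>

lemma nsets_gf_positive_mult_x_poch:
  "nsets_gf {0<..} r * x_poch r = fps_X ^ (r * (r + 1) div 2)"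
proof (induction r)
  case 0
  then show ?case
    by (simp add: nsets_gf_0 x_poch_def)
next
  case (Suc r)
  have "nsets_gf {0<..} (Suc r) = fps_X ^ Suc r * nsets_gf UNIV (Suc r)"
    using nsets_gf_Suc_image[of UNIV "Suc r"] by (simp only: greaterThan_0)
  also have "nsets_gf UNIV (Suc r) = nsets_gf {0<..} (Suc r) + nsets_gf {0<..} r"
  proof -
    have "UNIV - {0::nat} = {0<..}" by auto
    then show ?thesis using nsets_gf_Suc[of 0 UNIV r] by simp
  qed
  finally have "nsets_gf {0<..} (Suc r) * (1 - fps_X ^ Suc r) = fps_X ^ Suc r * nsets_gf {0<..} r"
    by (simp add: algebra_simps del: power_Suc)
  then have "nsets_gf {0<..} (Suc r) * x_poch (Suc r)
      = fps_X ^ Suc r * (nsets_gf {0<..} r * x_poch r)"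
    by (simp only: x_poch_Suc mult_ac)
  also have "\<dots> = fps_X ^ (Suc r * (Suc r + 1) div 2)"
    by (simp only: Suc.IH power_add[symmetric]) (simp add: algebra_simps)
  finally show ?case .
qed

lemma nsets_gf_positive: "nsets_gf {0<..} r = fps_X ^ (r * (r + 1) div 2) / x_poch r"
  using nsets_gf_positive_mult_x_poch[of r] x_poch_nth_0[of r]
  by (metis nonzero_mult_div_cancel_right fps_nonzero_nth zero_neq_one)

text \<open>Expand both terms on the right down to \<open>A - {a} - {Suc a}\<close>: the series for
  \<open>Suc r\<close> cancels, and the series for \<open>r\<close> keeps the coefficient x^a -
  x^(a+1).\<close>

lemma nsets_gf_remove_two:
  assumes "a \<in> A" "Suc a \<in> A"
  shows "(1 - fps_X) * (fps_X ^ a * nsets_gf (A - {a} - {Suc a}) r)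
       = nsets_gf (A - {Suc a}) (Suc r) - nsets_gf (A - {a}) (Suc r)"
proof -
  have "A - {Suc a} - {a} = A - {a} - {Suc a}" by auto
  then show ?thesis
    using nsets_gf_Suc[of a "A - {Suc a}" r] nsets_gf_Suc[of "Suc a" "A - {a}" r] assms
    by (simp add: algebra_simps)
qed

section \<open>Partitions as sets of first column hook lengths\<close>

definition beta_list :: "nat list \<Rightarrow> nat list" where
  "beta_list lam = map (\<lambda>j. lam ! j + (length lam - Suc j)) [0..<length lam]"

lemma length_beta_list [simp]: "length (beta_list lam) = length lam"
  by (simp add: beta_list_def)

lemma beta_list_nth [simp]:
  "j < length lam \<Longrightarrow> beta_list lam ! j = lam ! j + (length lam - Suc j)"
  by (simp add: beta_list_def)

lemma sum_list_beta_list: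
  "sum_list (beta_list lam) = sum_list lam + length lam * (length lam - 1) div 2"
proof -
  let ?m = "length lam"
  have "sum_list (beta_list lam) = (\<Sum>j<?m. lam ! j) + (\<Sum>j<?m. ?m - Suc j)"
    unfolding sum_list_sum_nth length_beta_list lessThan_atLeast0 sum.distrib[symmetric]
    by (rule sum.cong) simp_all
  also have "(\<Sum>j<?m. lam ! j) = sum_list lam"
    by (simp add: sum_list_sum_nth lessThan_atLeast0)
  also have "(\<Sum>j<?m. ?m - Suc j) = (\<Sum>j<?m. j)"
    by (rule sum.nat_diff_reindex)
  also have "\<dots> = ?m * (?m - 1) div 2"
    using Sum_Ico_nat[of 0 ?m] by (simp add: lessThan_atLeast0)
  finally show ?thesis .
qed

lemma sorted_wrt_beta_list:
  assumes "sorted_wrt (\<ge>) lam"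
  shows "sorted_wrt (>) (beta_list lam)"
  unfolding sorted_wrt_iff_nth_less
proof (intro allI impI)
  fix i j assume "i < j" "j < length (beta_list lam)"
  moreover from this have "lam ! i \<ge> lam ! j"
    using assms by (simp add: sorted_wrt_iff_nth_less)
  ultimately show "beta_list lam ! i > beta_list lam ! j"
    by simp
qed

lemma inj_beta_list: "inj beta_list"
proof (rule injI)
  fix l l' assume eq: "beta_list l = beta_list l'"
  then have len: "length l = length l'"
    by (metis length_beta_list)
  show "l = l'"
  proof (rule nth_equalityI[OF len])
    fix i assume "i < length l"
    then show "l ! i = l' ! i"
      using arg_cong[OF eq, of "\<lambda>l. l ! i"] len by simp
  qed
qed

text \<open>From position \<open>j\<close> on there are \<open>length l - j\<close> distinct
  positive entries, the largest of which is \<open>l ! j\<close>. Hence subtracting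
  \<open>length l - Suc j\<close> to invert \<open>beta_list\<close> never truncates and leaves
  positive parts.\<close>

lemma sorted_wrt_greater_nth_ge:
  assumes "sorted_wrt (>) (l :: nat list)" "\<forall>x\<in>set l. 0 < x" "j < length l"
  shows "l ! j \<ge> length l - j"
  using assms
proof (induction l arbitrary: j)
  case (Cons a l)
  show ?case
  proof (cases j)
    case 0
    then show ?thesis
      using Cons.prems Cons.IH[of 0] by (cases l) auto
  next
    case (Suc k)
    then show ?thesis using Cons.IH[of k] Cons.prems by simp
  qed
qed simp

lemma ex_partition_beta_list:
  assumes l: "sorted_wrt (>) l" "\<forall>x\<in>set l. 0 < x"
  obtains lam where "is_partition lam" "beta_list lam = l"
proof
  define lam where "lam = map (\<lambda>j. l ! j - (length l - Suc j)) [0..<length l]"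
  have ge: "l ! j \<ge> length l - j" if "j < length l" for j
    using sorted_wrt_greater_nth_ge[OF l that] .
  have [simp]: "length lam = length l"
    by (simp add: lam_def)
  have nth: "lam ! j = l ! j - (length l - Suc j)" if "j < length l" for j
    using that by (simp add: lam_def)
  have "transp ((\<ge>) :: nat \<Rightarrow> nat \<Rightarrow> bool)"
    by (auto intro: transpI)
  then have "sorted_wrt (\<ge>) lam"
  proof (subst sorted_wrt_iff_nth_Suc_transp, safe)
    \<comment> \<open>The strict drop of at least 1 in \<open>l\<close> makes up for the subtracted
      offset, which also drops by 1.\<close>
    fix i assume "Suc i < length lam"
    moreover from this have "l ! i > l ! Suc i"
      using l(1) by (simp add: sorted_wrt_iff_nth_less)
    ultimately show "lam ! Suc i \<le> lam ! i"
      by (simp add: nth)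
  qed
  moreover have "0 < p" if "p \<in> set lam" for p
    using that ge by (fastforce simp: lam_def)
  ultimately show "is_partition lam"
    by (simp add: is_partition_def)
  show "beta_list lam = l"
  proof (rule nth_equalityI)
    fix i assume "i < length (beta_list lam)"
    then show "beta_list lam ! i = l ! i"
      using ge[of i] by (simp add: nth)
  qed simp
qed

definition beta_set :: "nat list \<Rightarrow> nat set" where
  "beta_set lam = set (beta_list lam)"

lemma sorted_wrt_greater_iff: "sorted_wrt (>) l \<longleftrightarrow> sorted (rev l) \<and> distinct (l :: nat list)"
  using strict_sorted_iff[of "rev l"] by (simp add: sorted_wrt_rev)

lemma bij_betw_beta_set:
  "bij_betw beta_set (partitions_with_parts m) (nsets {0<..} m)"
  unfolding bij_betw_def
proof
  have sorted: "sorted_wrt (>) (beta_list lam)" if "lam \<in> partitions_with_parts m" for lam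
    using that by (auto simp: partitions_with_parts_def is_partition_def intro: sorted_wrt_beta_list)
  show "inj_on beta_set (partitions_with_parts m)"
  proof (rule inj_onI)
    fix l l' assume *: "l \<in> partitions_with_parts m" "l' \<in> partitions_with_parts m"
      and "beta_set l = beta_set l'"
    \<comment> \<open>Reversed, both lists are increasing without repetition, hence determined by
      their sets.\<close>
    then have "rev (beta_list l) = rev (beta_list l')"
      by (intro sorted_distinct_set_unique)
        (use sorted[OF *(1)] sorted[OF *(2)] in \<open>auto simp: sorted_wrt_greater_iff beta_set_def\<close>)
    then show "l = l'"
      using inj_beta_list by (simp add: inj_def)
  qed
  show "beta_set ` partitions_with_parts m = nsets {0<..} m"
  proof
    show "beta_set ` partitions_with_parts m \<subseteq> nsets {0<..} m"
    proof safe
      fix lam assume lam: "lam \<in> partitions_with_parts m"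
      then have "card (beta_set lam) = m"
        using sorted[OF lam] unfolding beta_set_def
        by (subst distinct_card) (auto simp: sorted_wrt_greater_iff partitions_with_parts_def)
      moreover have "0 < b" if b: "b \<in> beta_set lam" for b
      proof -
        obtain j where "j < length lam" "b = lam ! j + (length lam - Suc j)"
          using b by (auto simp: beta_set_def beta_list_def)
        moreover from this have "0 < lam ! j"
          using lam by (simp add: partitions_with_parts_def is_partition_def)
        ultimately show ?thesis
          by simp
      qed
      ultimately show "beta_set lam \<in> nsets {0<..} m"
        by (auto simp: nsets_def beta_set_def)
    qed
  next
    show "nsets {0<..} m \<subseteq> beta_set ` partitions_with_parts m"
    proof
      fix B :: "nat set" assume B: "B \<in> nsets {0<..} m"
      define l where "l = rev (sorted_list_of_set B)"
      have l: "set l = B" "length l = m" "sorted_wrt (>) l" "\<forall>x\<in>set l. 0 < x"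
        using B by (auto simp: l_def nsets_def sorted_wrt_greater_iff)
      obtain lam where "is_partition lam" "beta_list lam = l"
        using ex_partition_beta_list[OF l(3,4)] .
      then show "B \<in> beta_set ` partitions_with_parts m"
        using l(1,2) by (auto simp: beta_set_def partitions_with_parts_def intro!: image_eqI[of _ _ lam])
    qed
  qed
qed

lemma sum_beta_set:
  assumes "lam \<in> partitions_with_parts m"
  shows "\<Sum> (beta_set lam) = sum_list lam + m * (m - 1) div 2"
proof -
  have len: "length lam = m" and "sorted_wrt (>) (beta_list lam)"
    using assms by (auto simp: partitions_with_parts_def is_partition_def intro: sorted_wrt_beta_list)
  then have "\<Sum> (beta_set lam) = sum_list (beta_list lam)"
    by (simp add: beta_set_def sum_list_distinct_conv_sum_set[of _ "\<lambda>x. x", simplified]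
        sorted_wrt_greater_iff)
  then show ?thesis
    by (simp add: sum_list_beta_list len)
qed

section \<open>The condition on the parts in terms of hook lengths\<close>

lemma mem_beta_set_iff:
  "b \<in> beta_set lam \<longleftrightarrow> (\<exists>k\<in>{1..length lam}. part lam k + length lam = b + k)"
proof
  assume "b \<in> beta_set lam"
  then obtain j where "j < length lam" "b = lam ! j + (length lam - Suc j)"
    by (auto simp: beta_set_def beta_list_def)
  then show "\<exists>k\<in>{1..length lam}. part lam k + length lam = b + k"
    by (intro bexI[of _ "Suc j"]) (auto simp: part_def)
next
  assume "\<exists>k\<in>{1..length lam}. part lam k + length lam = b + k"
  then obtain k where k: "k \<in> {1..length lam}" "part lam k + length lam = b + k" ..
  then have "b = beta_list lam ! (k - 1)" "k - 1 < length (beta_list lam)"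
    by (auto simp: part_def)
  then show "b \<in> beta_set lam"
    by (simp only: beta_set_def nth_mem)
qed

lemma part_antimono:
  assumes "is_partition lam" "1 \<le> i" "i \<le> j" "j \<le> length lam"
  shows "part lam j \<le> part lam i"
proof (cases "i = j")
  case False
  then show ?thesis
    using assms unfolding part_def is_partition_def sorted_wrt_iff_nth_less by simp
qed simp

text \<open>The sequence \<open>part lam k - k\<close>, read in the integers, is strictly
  decreasing. The left side says that it takes the value 0 and skips the value 1; the alternative
  \<open>part lam 1 = 1\<close> is the case k = 1, where no earlier part exists.\<close>

lemma fixed_part_iff_beta_set:
  assumes lam: "lam \<in> partitions_with_parts m" and m: "m \<ge> 1"
  shows "part lam 1 = 1 \<or> (\<exists>k\<in>{2..m}. part lam (k - 1) > part lam k \<and> part lam k = k)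
    \<longleftrightarrow> m \<in> beta_set lam \<and> Suc m \<notin> beta_set lam" (is "?L \<longleftrightarrow> ?R")
proof -
  have len: "length lam = m" and part: "is_partition lam"
    using lam by (auto simp: partitions_with_parts_def)
  have anti: "part lam j \<le> part lam i" if "1 \<le> i" "i \<le> j" "j \<le> m" for i j
    using part_antimono[OF part] that len by simp
  \<comment> \<open>With \<open>length lam = m\<close>, the hook length at k is \<open>m\<close> iff
    the part equals k, and \<open>Suc m\<close> iff it equals k + 1.\<close>
  have R: "?R \<longleftrightarrow> (\<exists>k\<in>{1..m}. part lam k = k) \<and> (\<forall>k\<in>{1..m}. part lam k \<noteq> Suc k)"
    by (auto simp: mem_beta_set_iff len)
  show ?thesis
    unfolding R
  proof
    assume ?L
    then consider "part lam 1 = 1"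
      | k where "k \<in> {2..m}" "part lam (k - 1) > part lam k" "part lam k = k"
      by blast
    then show "(\<exists>k\<in>{1..m}. part lam k = k) \<and> (\<forall>k\<in>{1..m}. part lam k \<noteq> Suc k)"
    proof cases
      case 1
      then have "\<forall>k\<in>{1..m}. part lam k \<noteq> Suc k"
        using anti[of 1] by fastforce
      then show ?thesis
        using 1 m by auto
    next
      case (2 k)
      have "part lam i \<noteq> Suc i" if i: "i \<in> {1..m}" for i
      proof (cases "i < k")
        case True
        \<comment> \<open>Before position k, parts are at least \<open>part lam (k - 1)\<close>, so
          exceed k, which is at least i + 1; from k on they are at most k, so at most i.\<close>
        then have "part lam (k - 1) \<le> part lam i"
          using 2 i by (intro anti) auto
        then show ?thesis
          using 2 True by auto
      next
        case False
        then have "part lam i \<le> part lam k"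
          using 2 i by (intro anti) auto
        then show ?thesis
          using 2 False by auto
      qed
      then show ?thesis
        using 2 by (intro conjI bexI[of _ k]) auto
    qed
  next
    assume r: "(\<exists>k\<in>{1..m}. part lam k = k) \<and> (\<forall>k\<in>{1..m}. part lam k \<noteq> Suc k)"
    then obtain k where k: "k \<in> {1..m}" "part lam k = k" by blast
    show ?L
    proof (cases "k = 1")
      case True
      then show ?thesis using k by simp
    next
      case False
      then have "k - 1 \<in> {1..m}" "Suc (k - 1) = k" "k \<in> {2..m}"
        using k by auto
      \<comment> \<open>Instantiating the second half of \<open>r\<close> at k - 1 turns the weak
        inequality of neighbouring parts into a strict one.\<close>
      moreover from this have "part lam (k - 1) \<noteq> k"
        using r by metis
      moreover have "part lam k \<le> part lam (k - 1)"
        using \<open>k \<in> {2..m}\<close> by (intro anti) auto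
      ultimately show ?thesis
        using k(2) by (intro disjI2 bexI[of _ k]) auto
    qed
  qed
qed

text \<open>On the left, the power of x is the excess of the hook length sum over the size of the
  partition; on the right, x^m accounts for the forced element \<open>m\<close>.\<close>

lemma size_gf_fixed_part:
  assumes m: "m \<ge> 1"
  shows "fps_X ^ (m * (m - 1) div 2) * size_gf {lam \<in> partitions_with_parts m.
             part lam 1 = 1 \<or>
             (\<exists>k\<in>{2..m}. part lam (k - 1) > part lam k \<and> part lam k = k)}
         = fps_X ^ m * nsets_gf ({0<..} - {m} - {Suc m}) (m - 1)"
proof -
  let ?S = "{lam \<in> partitions_with_parts m. part lam 1 = 1 \<or>
             (\<exists>k\<in>{2..m}. part lam (k - 1) > part lam k \<and> part lam k = k)}"
  let ?T = "{B \<in> nsets ({0<..} - {Suc m}) (Suc (m - 1)). m \<in> B}"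
  have S: "?S = {lam \<in> partitions_with_parts m. m \<in> beta_set lam \<and> Suc m \<notin> beta_set lam}"
    by (rule Collect_cong, rule conj_cong[OF refl], rule fixed_part_iff_beta_set[OF _ m])
  have T: "?T = {B \<in> nsets {0<..} m. m \<in> B \<and> Suc m \<notin> B}"
    using m by (auto simp: nsets_def)
  have "bij_betw beta_set ?S ?T"
    unfolding bij_betw_def
  proof
    show "inj_on beta_set ?S"
      using bij_betw_beta_set[of m] by (auto simp: bij_betw_def intro: inj_on_subset)
    show "beta_set ` ?S = ?T"
      unfolding S T bij_betw_imp_surj_on[OF bij_betw_beta_set, symmetric] by blast
  qed
  then have "weight_gf \<Sum> ?T = fps_X ^ (m * (m - 1) div 2) * size_gf ?S"
    unfolding size_gf_eq_weight_gf by (rule weight_gf_bij_betw) (rule sum_beta_set, blast)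
  moreover have "{0<..} - {Suc m} - {m} = {0<..} - {m} - {Suc m}"
    by auto
  then have "weight_gf \<Sum> ?T = fps_X ^ m * nsets_gf ({0<..} - {m} - {Suc m}) (m - 1)"
    using weight_gf_nsets_containing[of m "{0<..} - {Suc m}" "m - 1"] m by simp
  ultimately show ?thesis
    by simp
qed

section \<open>Exponent arithmetic and the final formula\<close>

lemma triangular_exponent:
  assumes "i \<le> (m::nat)"
  shows "m * i + (m - i) * (m - i + 1) div 2 = m * (m - 1) div 2 + m + i * (i - 1) div 2"
proof -
  obtain d where d: "m = i + d"
    using assms le_Suc_ex by blast
  have tri: "2 * (n * (n - 1) div 2) = n * (n - 1)" "2 * (n * (n + 1) div 2) = n * (n + 1)" for n :: nat
    by (cases n; auto intro!: dvd_mult_div_cancel simp del: mult_Suc mult_Suc_right)+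
  have pred: "n * (n - 1) + n = n * n" for n :: nat
    by (cases n) auto
  have "m * m = i * i + 2 * (d * i) + d * d" "m * i = i * i + d * i" "d * (d + 1) = d * d + d"
    by (simp_all add: d algebra_simps)
  \<comment> \<open>Doubling clears the halves, and the extra i completes \<open>i * (i - 1)\<close>
    to a square, so no truncated subtraction remains.\<close>
  then have "2 * (m * i + d * (d + 1) div 2) + i = 2 * (m * (m - 1) div 2 + m + i * (i - 1) div 2) + i"
    using pred[of m] pred[of i] d unfolding distrib_left[of 2] tri by linarith
  then show ?thesis
    by (simp add: d)
qed

theorem theorem1p3:
  fixes m :: nat
  assumes "m \<ge> 1"
  shows "size_gf {lam \<in> partitions_with_parts m.
             part lam 1 = 1 \<or>
             (\<exists>k\<in>{2..m}. part lam (k - 1) > part lam k \<and> part lam k = k)}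
         = fps_X ^ m / (1 - fps_X) *
           (\<Sum>i=1..m. (-1) ^ i * fps_X ^ (i * (i - 1) div 2) * (fps_X ^ i - 1) / x_poch (m - i))"
    (is "?G = _ * ?R")
proof -
  let ?t = "m * (m - 1) div 2" and ?P = "{0<..} :: nat set"
  let ?c = "\<lambda>i. (-1) ^ i * fps_X ^ (i * (i - 1) div 2) * (fps_X ^ i - 1) / x_poch (m - i)"
  have m: "Suc (m - 1) = m"
    using assms by simp
  have unit: "a / x_poch j = a * inverse (x_poch j)" for a j
    by (rule fps_divide_unit) (simp add: x_poch_nth_0)
  \<comment> \<open>These are the i-th terms of \<open>nsets_gf_remove\<close> for
    \<open>Suc m\<close> and for \<open>m\<close>; their difference carries the factor x^(m i) (x^i
    - 1).\<close>
  have diff: "(-1) ^ i * fps_X ^ (Suc m * i) * nsets_gf ?P (m - i)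
      - (-1) ^ i * fps_X ^ (m * i) * nsets_gf ?P (m - i) = fps_X ^ (?t + m) * ?c i"
    if "i \<le> m" for i
  proof -
    have "(-1) ^ i * fps_X ^ (Suc m * i) * nsets_gf ?P (m - i)
        - (-1) ^ i * fps_X ^ (m * i) * nsets_gf ?P (m - i)
      = (-1) ^ i * fps_X ^ (m * i + (m - i) * (m - i + 1) div 2) * (fps_X ^ i - 1)
        * inverse (x_poch (m - i))"
      unfolding nsets_gf_positive unit by (simp add: power_add algebra_simps)
    also have "\<dots> = fps_X ^ (?t + m) * ?c i"
      unfolding triangular_exponent[OF that] unit by (simp only: power_add mult_ac)
    finally show ?thesis .
  qed
  have "fps_X ^ ?t * ((1 - fps_X) * ?G)
      = (1 - fps_X) * (fps_X ^ m * nsets_gf (?P - {m} - {Suc m}) (m - 1))"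
    using size_gf_fixed_part[OF assms] by (simp add: mult.left_commute)
  also have "\<dots> = nsets_gf (?P - {Suc m}) m - nsets_gf (?P - {m}) m"
    using nsets_gf_remove_two[of m ?P "m - 1"] assms by (simp add: m)
  also have "\<dots> = (\<Sum>i\<le>m. fps_X ^ (?t + m) * ?c i)"
    using assms by (simp add: nsets_gf_remove sum_subtractf[symmetric] diff del: mult_Suc)
  also have "\<dots> = fps_X ^ (?t + m) * (\<Sum>i\<le>m. ?c i)"
    by (simp only: sum_distrib_left)
  \<comment> \<open>The term i = 0 vanishes because of its factor x^0 - 1.\<close>
  also have "(\<Sum>i\<le>m. ?c i) = ?R"
    by (simp add: atMost_atLeast0 sum.atLeast_Suc_atMost)
  finally have "fps_X ^ ?t * ((1 - fps_X) * ?G) = fps_X ^ ?t * (fps_X ^ m * ?R)"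
    by (simp only: power_add mult.assoc)
  then have G: "(1 - fps_X) * ?G = fps_X ^ m * ?R"
    by (simp only: mult_cancel_left) simp
  have inv: "inverse (1 - fps_X) * (1 - fps_X :: rat fps) = 1"
    by (rule inverse_mult_eq_1) simp
  have "?G = inverse (1 - fps_X) * ((1 - fps_X) * ?G)"
    by (simp only: mult.assoc[symmetric] inv mult_1)
  also have "\<dots> = fps_X ^ m * inverse (1 - fps_X) * ?R"
    by (simp only: G mult_ac)
  also have "fps_X ^ m * inverse (1 - fps_X) = fps_X ^ m / (1 - fps_X :: rat fps)"
    by (rule fps_divide_unit[symmetric]) simp
  finally show ?thesis .
qed

end
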